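(* Let $X$ be a separable Hilbert space with orthonormal basis $\{\varphi_k\}_{k\in\mathbb{N}}$, let $d \in \mathbb{N}$, $C_-, C_+ > 0$, and let $\{\alpha_k\}_{k\in\mathbb{N}}$ be a positive, non-decreasing sequence with $C_- k^{2/d} \le \alpha_k \le C_+ k^{2/d}$ for all $k$. Let $u^\dagger \in X$, $r > 0$, $\tau > d/2$, and assume that $y$ is an $X$-valued random variable with $y \sim \mathcal{L}_{e^{-A}u^\dagger,\, b^2A^{-\beta}}$, where $b > 0$ and $\beta > d/2$. If there exist $w \in X$ and $\rho > 0$ such that $$u^\dagger = A^{\frac{\beta}{2}-\tau}e^{-A}w \quad\text{and}\quad \sup_{k\in\mathbb{N}}|(w,\varphi_k)_X| \le \rho,$$ and if there exists $C > 0$ such that $$\frac{\rho}{\sqrt{2}}\,b \le r^2 \le C b,$$ then $$\mathbb{E}\left[\|\hat{u}_{\mathrm{MAP}}(y) - u^\dagger\|_X^2\right] \le 2C\,(\operatorname{tr}A^{-\tau})\,b .$$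
   Context: $A$ is the unbounded operator on $X$ with $A\varphi_k = \alpha_k\varphi_k$; functions of $A$ are defined by functional calculus: $A^s x = \sum_k \alpha_k^s(x,\varphi_k)_X\varphi_k$ and $e^{-A}x = \sum_k e^{-\alpha_k}(x,\varphi_k)_X\varphi_k$. $\mathcal{X}^\tau = \{x \in X: \sum_k \alpha_k^\tau|(x,\varphi_k)_X|^2 < \infty\}$ with $\|x\|_{\mathcal{X}^\tau} = \|A^{\tau/2}x\|_X$. $\mathcal{L}_{a,b^2A^{-\beta}}$, for $a \in X$, is the distribution of $\sum_{k=1}^\infty \xi_k\varphi_k$, where $(\xi_k)_{k \in \mathbb{N}}$ are independent real random variables and $\xi_k$ has the Laplace distribution with mean $(a,\varphi_k)_X$ and variance $b^2\alpha_k^{-\beta}$. The maximum a posteriori estimator $\hat{u}_{\mathrm{MAP}}: X \to X$ is $$\hat{u}_{\mathrm{MAP}}(y) = \arg\min_{u\in\mathcal{X}^\tau}\left\{\Phi(u,y) + \frac{1}{2r^2}\|u\|_{\mathcal{X}^\tau}^2\right\}, \qquad \Phi(u,y) = \sqrt{2}\sum_{k=1}^\infty \frac{|(y,\varphi_k)_X - e^{-\alpha_k}(u,\varphi_k)_X| - |(y,\varphi_k)_X|}{b\,\alpha_k^{-\beta/2}},$$ where the minimizer exists and is unique for every $y \in X$; it is the unique mode of the posterior distribution for the model $y = e^{-A}u + \eta$ with noise $\eta \sim \mathcal{L}_{0,b^2A^{-\beta}}$ and Gaussian prior $\mathcal{N}_{r^2A^{-\tau}}$. *)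

theory Defs
  imports "HOL-Probability.Probability"
begin

text \<open>
  The Hilbert space is a real type of class real_inner, banach and second_countable_topology.
  Indices run over nat starting from 0, so \<open>\<phi> k\<close> and \<open>\<alpha> k\<close> stand for the basis vector and the
  eigenvalue with number \<open>k + 1\<close>.
\<close>

definition orthonormal_basis :: "(nat \<Rightarrow> 'a::real_inner) \<Rightarrow> bool" where
  "orthonormal_basis \<phi> \<longleftrightarrow>
     (\<forall>i j. inner (\<phi> i) (\<phi> j) = (if i = j then 1 else 0)) \<and> closure (span (range \<phi>)) = UNIV"

text \<open>
  Functional calculus \<open>f(A)\<close> for the diagonal operator \<open>A (\<phi> k) = \<alpha> k *\<^sub>R \<phi> k\<close>. For unbounded
  \<open>f(A)\<close> the value is meaningful only where the series converges, i.e. on the domain of \<open>f(A)\<close>.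
\<close>

definition fun_calc ::
  "(nat \<Rightarrow> 'a::real_inner) \<Rightarrow> (nat \<Rightarrow> real) \<Rightarrow> (real \<Rightarrow> real) \<Rightarrow> 'a \<Rightarrow> 'a" where
  "fun_calc \<phi> \<alpha> f x = (\<Sum>k. (f (\<alpha> k) * inner x (\<phi> k)) *\<^sub>R \<phi> k)"

definition A_powr :: "(nat \<Rightarrow> 'a::real_inner) \<Rightarrow> (nat \<Rightarrow> real) \<Rightarrow> real \<Rightarrow> 'a \<Rightarrow> 'a" where
  "A_powr \<phi> \<alpha> s = fun_calc \<phi> \<alpha> (\<lambda>t. t powr s)"

definition exp_neg_A :: "(nat \<Rightarrow> 'a::real_inner) \<Rightarrow> (nat \<Rightarrow> real) \<Rightarrow> 'a \<Rightarrow> 'a" where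
  "exp_neg_A \<phi> \<alpha> = fun_calc \<phi> \<alpha> (\<lambda>t. exp (- t))"

definition op_trace :: "(nat \<Rightarrow> 'a::real_inner) \<Rightarrow> ('a \<Rightarrow> 'a) \<Rightarrow> real" where
  "op_trace \<phi> T = (\<Sum>k. inner (T (\<phi> k)) (\<phi> k))"

definition X_space :: "(nat \<Rightarrow> 'a::real_inner) \<Rightarrow> (nat \<Rightarrow> real) \<Rightarrow> real \<Rightarrow> 'a set" where
  "X_space \<phi> \<alpha> \<tau> = {x. summable (\<lambda>k. \<alpha> k powr \<tau> * \<bar>inner x (\<phi> k)\<bar>\<^sup>2)}"

definition X_norm :: "(nat \<Rightarrow> 'a::real_inner) \<Rightarrow> (nat \<Rightarrow> real) \<Rightarrow> real \<Rightarrow> 'a \<Rightarrow> real" where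
  "X_norm \<phi> \<alpha> \<tau> x = norm (A_powr \<phi> \<alpha> (\<tau> / 2) x)"

text \<open>
  Laplace distribution with mean \<open>m\<close> and variance \<open>v > 0\<close>. The density with location \<open>m\<close> and
  scale \<open>s\<close> is \<open>exp (- \<bar>x - m\<bar> / s) / (2 * s)\<close>; its variance is \<open>2 * s\<^sup>2\<close>, so \<open>s = sqrt (v / 2)\<close>.
\<close>

definition laplace_density :: "real \<Rightarrow> real \<Rightarrow> real \<Rightarrow> real" where
  "laplace_density m v x = exp (- \<bar>x - m\<bar> / sqrt (v / 2)) / (2 * sqrt (v / 2))"

definition laplace :: "real \<Rightarrow> real \<Rightarrow> real measure" where
  "laplace m v = density lborel (\<lambda>x. ennreal (laplace_density m v x))"

text \<open>
  The measure \<open>\<L>\<close> with mean \<open>a\<close> and covariance \<open>b\<^sup>2 A\<close> to the power \<open>-\<beta>\<close>: the law of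
  \<open>\<Sum>k. \<xi> k *\<^sub>R \<phi> k\<close>, where the family \<open>\<xi>\<close> is realized as the coordinates of the infinite product
  space; these are independent with the prescribed Laplace laws.
\<close>

definition laplace_measure ::
  "(nat \<Rightarrow> 'a::{real_inner, banach, second_countable_topology}) \<Rightarrow> (nat \<Rightarrow> real) \<Rightarrow> 'a \<Rightarrow> real \<Rightarrow> real
     \<Rightarrow> 'a measure" where
  "laplace_measure \<phi> \<alpha> a b \<beta> =
     distr (\<Pi>\<^sub>M k\<in>UNIV. laplace (inner a (\<phi> k)) (b\<^sup>2 * \<alpha> k powr (- \<beta>))) borel
       (\<lambda>\<xi>. \<Sum>k. \<xi> k *\<^sub>R \<phi> k)"

text \<open>Any independent family with these marginals gives the same law.\<close>

lemma (in prob_space) laplace_measure_indep: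
  fixes \<phi> :: "nat \<Rightarrow> 'b::{real_inner, banach, second_countable_topology}"
  assumes indep: "indep_vars (\<lambda>_. borel) \<xi> UNIV"
    and law: "\<And>k. distr M borel (\<xi> k) = laplace (inner a (\<phi> k)) (b\<^sup>2 * \<alpha> k powr (- \<beta>))"
  shows "distr M borel (\<lambda>\<omega>. \<Sum>k. \<xi> k \<omega> *\<^sub>R \<phi> k) = laplace_measure \<phi> \<alpha> a b \<beta>"
proof -
  have rv[measurable]: "\<xi> k \<in> borel_measurable M" for k
    using indep by (auto simp: indep_vars_def)
  have "distr M (\<Pi>\<^sub>M k\<in>UNIV. borel) (\<lambda>\<omega>. \<lambda>k\<in>UNIV. \<xi> k \<omega>)
          = (\<Pi>\<^sub>M k\<in>UNIV. distr M borel (\<xi> k))"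
    using indep indep_vars_iff_distr_eq_PiM[where I = "UNIV :: nat set" and M' = "\<lambda>_. borel" and X = \<xi>] by simp
  then have PiM: "(\<Pi>\<^sub>M k\<in>UNIV. laplace (inner a (\<phi> k)) (b\<^sup>2 * \<alpha> k powr (- \<beta>)))
          = distr M (\<Pi>\<^sub>M k\<in>UNIV. borel) (\<lambda>\<omega>. \<lambda>k\<in>UNIV. \<xi> k \<omega>)"
    by (simp add: law)
  show ?thesis
    unfolding laplace_measure_def PiM
    by (subst distr_distr) (simp_all add: comp_def)
qed

definition Phi ::
  "(nat \<Rightarrow> 'a::real_inner) \<Rightarrow> (nat \<Rightarrow> real) \<Rightarrow> real \<Rightarrow> real \<Rightarrow> 'a \<Rightarrow> 'a \<Rightarrow> real" where
  "Phi \<phi> \<alpha> b \<beta> u y =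
     sqrt 2 * (\<Sum>k. (\<bar>inner y (\<phi> k) - exp (- \<alpha> k) * inner u (\<phi> k)\<bar> - \<bar>inner y (\<phi> k)\<bar>)
                     / (b * \<alpha> k powr (- \<beta> / 2)))"

definition u_MAP ::
  "(nat \<Rightarrow> 'a::real_inner) \<Rightarrow> (nat \<Rightarrow> real) \<Rightarrow> real \<Rightarrow> real \<Rightarrow> real \<Rightarrow> real \<Rightarrow> 'a \<Rightarrow> 'a" where
  "u_MAP \<phi> \<alpha> b \<beta> r \<tau> y =
     arg_min_on (\<lambda>u. Phi \<phi> \<alpha> b \<beta> u y + 1 / (2 * r\<^sup>2) * (X_norm \<phi> \<alpha> \<tau> u)\<^sup>2) (X_space \<phi> \<alpha> \<tau>)"

end

(*
  In the eigenbasis the functional defining the estimator splits into scalar problems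
  p R |z - v| + p v^2 / 2, where z = exp(alpha_k) y_k and p = alpha_k^tau / r^2; each has as its
  unique minimizer the truncation of z to [-R, R]. The source condition and rho b / sqrt 2 <= r^2
  say exactly that the coordinates of u_dagger lie in these intervals, so truncation moves z no
  further from u_dagger and the squared error in coordinate k is at most 2 R |z - u_dagger_k|.
  The mean of |z - u_dagger_k| is the scale 1 / (p R) of the Laplace law of z, which gives the
  mean squared error 2 / p = 2 r^2 alpha_k^(-tau) per coordinate; summing over k gives the trace.
*)
theory Submission
  imports Defs "HOL-Real_Asymp.Real_Asymp"
begin

section \<open>Orthonormal series and functional calculus\<close>

lemma orthonormal_basisD:
  "orthonormal_basis \<phi> \<Longrightarrow> inner (\<phi> i) (\<phi> j) = (if i = j then 1 else 0)"
  by (simp add: orthonormal_basis_def)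

text \<open>Riesz-Fischer: by Pythagoras the blocks of the vector series have squared norm equal to
  the blocks of \<open>(c k)\<^sup>2\<close>, so its partial sums are Cauchy and converge by
  completeness of the space. Continuity of \<open>inner\<close> then gives coefficients and
  norm.\<close>

lemma orthonormal_series:
  fixes \<phi> :: "nat \<Rightarrow> 'a::{real_inner, banach}"
  assumes basis: "orthonormal_basis \<phi>" and sq: "summable (\<lambda>k. (c k)\<^sup>2)"
  shows orthonormal_series_summable: "summable (\<lambda>k. c k *\<^sub>R \<phi> k)"
    and orthonormal_series_inner: "inner (\<Sum>k. c k *\<^sub>R \<phi> k) (\<phi> j) = c j"
    and orthonormal_series_norm: "(norm (\<Sum>k. c k *\<^sub>R \<phi> k))\<^sup>2 = (\<Sum>k. (c k)\<^sup>2)"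
proof -
  note [simp] = orthonormal_basisD[OF basis]
  have pyth: "(norm (\<Sum>k\<in>I. c k *\<^sub>R \<phi> k))\<^sup>2 = (\<Sum>k\<in>I. (c k)\<^sup>2)" if "finite I" for I
    using that
    by (subst norm_sum_Pythagorean)
       (auto simp: pairwise_def orthogonal_def power_mult_distrib power2_norm_eq_inner)
  show summ: "summable (\<lambda>k. c k *\<^sub>R \<phi> k)"
    unfolding summable_Cauchy
  proof (intro allI impI)
    fix e :: real assume "e > 0"
    then obtain N where N: "\<And>m n. m \<ge> N \<Longrightarrow> norm (\<Sum>k=m..<n. (c k)\<^sup>2) < e\<^sup>2"
      using sq[unfolded summable_Cauchy] by (meson zero_less_power)
    have "norm (\<Sum>k=m..<n. c k *\<^sub>R \<phi> k) < e" if "m \<ge> N" for m n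
    proof (rule power2_less_imp_less)
      show "(norm (\<Sum>k=m..<n. c k *\<^sub>R \<phi> k))\<^sup>2 < e\<^sup>2"
        using N[OF that, of n] by (subst pyth) auto
    qed (use \<open>e > 0\<close> in simp)
    then show "\<exists>N. \<forall>m\<ge>N. \<forall>n. norm (\<Sum>k=m..<n. c k *\<^sub>R \<phi> k) < e"
      by blast
  qed
  have inner: "inner (\<Sum>k. c k *\<^sub>R \<phi> k) (\<phi> j) = c j" for j
  proof -
    have "inner (\<Sum>k. c k *\<^sub>R \<phi> k) (\<phi> j) = (\<Sum>k. inner (c k *\<^sub>R \<phi> k) (\<phi> j))"
      by (rule bounded_linear.suminf[OF bounded_linear_inner_left summ])
    also have "\<dots> = (\<Sum>k\<in>{j}. inner (c k *\<^sub>R \<phi> k) (\<phi> j))"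
      by (intro suminf_finite) auto
    finally show ?thesis by simp
  qed
  show "inner (\<Sum>k. c k *\<^sub>R \<phi> k) (\<phi> j) = c j"
    by (rule inner)
  have "inner (\<Sum>k. c k *\<^sub>R \<phi> k) (\<Sum>k. c k *\<^sub>R \<phi> k)
      = (\<Sum>k. inner (c k *\<^sub>R \<phi> k) (\<Sum>k. c k *\<^sub>R \<phi> k))"
    by (rule bounded_linear.suminf[OF bounded_linear_inner_left summ])
  also have "\<dots> = (\<Sum>k. (c k)\<^sup>2)"
    by (simp add: inner_commute[of "\<phi> _"] inner power2_eq_square)
  finally show "(norm (\<Sum>k. c k *\<^sub>R \<phi> k))\<^sup>2 = (\<Sum>k. (c k)\<^sup>2)"
    by (simp add: power2_norm_eq_inner)
qed

text \<open>The vectors orthogonal to \<open>x - z\<close> form a closed set containing the span of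
  the basis, hence everything, including \<open>x - z\<close> itself.\<close>

lemma orthonormal_basis_eqI:
  fixes \<phi> :: "nat \<Rightarrow> 'a::real_inner"
  assumes basis: "orthonormal_basis \<phi>" and eq: "\<And>k. inner x (\<phi> k) = inner z (\<phi> k)"
  shows "x = z"
proof -
  have "inner (x - z) v = 0" if "v \<in> span (range \<phi>)" for v
    using orthogonal_to_span[OF that, of "x - z"] eq
    by (auto simp: orthogonal_def inner_diff_left)
  then have "span (range \<phi>) \<subseteq> {v. inner (x - z) v = 0}"
    by blast
  moreover have "closed {v. inner (x - z) v = 0}"
    by (intro closed_Collect_eq continuous_intros)
  ultimately have "closure (span (range \<phi>)) \<subseteq> {v. inner (x - z) v = 0}"
    by (rule closure_minimal)
  then have "x - z \<in> {v. inner (x - z) v = 0}"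
    using basis unfolding orthonormal_basis_def by blast
  then show ?thesis by simp
qed

lemma bessel_summable:
  fixes \<phi> :: "nat \<Rightarrow> 'a::real_inner"
  assumes basis: "orthonormal_basis \<phi>"
  shows "summable (\<lambda>k. (inner x (\<phi> k))\<^sup>2)"
proof (rule summableI_nonneg_bounded)
  fix n
  note [simp] = orthonormal_basisD[OF basis]
  define p where "p = (\<Sum>k<n. inner x (\<phi> k) *\<^sub>R \<phi> k)"
  have xp: "inner x p = (\<Sum>k<n. (inner x (\<phi> k))\<^sup>2)"
    by (simp add: p_def inner_sum_right power2_eq_square)
  have "inner p (\<phi> j) = inner x (\<phi> j)" if "j < n" for j
    using that by (simp add: p_def inner_sum_left if_distrib sum.delta' cong: if_cong)
  then have "inner p p = inner x p"
    \<comment> \<open>Only the right factor of \<open>inner p p\<close> is expanded, so that the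
      known coefficients \<open>inner p (\<phi> j)\<close> appear.\<close>
    unfolding p_def[symmetric] xp by (subst (2) p_def) (simp add: inner_sum_right power2_eq_square)
  then have "0 \<le> inner x x - inner x p"
    using inner_ge_zero[of "x - p"] by (simp add: inner_diff_left inner_diff_right inner_commute)
  then show "(\<Sum>k<n. (inner x (\<phi> k))\<^sup>2) \<le> inner x x"
    by (simp add: xp)
qed simp

lemma parseval:
  fixes \<phi> :: "nat \<Rightarrow> 'a::{real_inner, banach}"
  assumes basis: "orthonormal_basis \<phi>"
  shows "(norm x)\<^sup>2 = (\<Sum>k. (inner x (\<phi> k))\<^sup>2)"
proof -
  note s = bessel_summable[OF basis, of x]
  have "x = (\<Sum>k. inner x (\<phi> k) *\<^sub>R \<phi> k)"
    by (rule orthonormal_basis_eqI[OF basis]) (simp add: orthonormal_series_inner[OF basis s])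
  then show ?thesis
    using orthonormal_series_norm[OF basis s] by simp
qed

text \<open>Square summability is the condition that \<open>x\<close> lies in the domain of
  \<open>f(A)\<close>; it guarantees that the defining series converges.\<close>

lemma fun_calc_inner:
  fixes \<phi> :: "nat \<Rightarrow> 'a::{real_inner, banach}"
  assumes "orthonormal_basis \<phi>" "summable (\<lambda>k. (f (\<alpha> k) * inner x (\<phi> k))\<^sup>2)"
  shows "inner (fun_calc \<phi> \<alpha> f x) (\<phi> k) = f (\<alpha> k) * inner x (\<phi> k)"
  unfolding fun_calc_def by (rule orthonormal_series_inner[OF assms])

text \<open>Positive eigenvalues give \<open>exp (- \<alpha> k) \<le> 1\<close>, so the operator is
  bounded and every \<open>x\<close> lies in its domain.\<close>

lemma exp_neg_A_inner:
  fixes \<phi> :: "nat \<Rightarrow> 'a::{real_inner, banach}"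
  assumes basis: "orthonormal_basis \<phi>" and pos: "\<And>k. \<alpha> k > 0"
  shows "inner (exp_neg_A \<phi> \<alpha> x) (\<phi> k) = exp (- \<alpha> k) * inner x (\<phi> k)"
  unfolding exp_neg_A_def
proof (rule fun_calc_inner[OF basis])
  have "exp (- \<alpha> k) \<le> 1" for k
    using pos[of k] by simp
  then have "(exp (- \<alpha> k) * inner x (\<phi> k))\<^sup>2 \<le> (inner x (\<phi> k))\<^sup>2" for k
    by (simp add: power_mult_distrib mult_left_le_one_le power_le_one)
  then show "summable (\<lambda>k. (exp (- \<alpha> k) * inner x (\<phi> k))\<^sup>2)"
    by (intro summable_comparison_test'[OF bessel_summable[OF basis, of x], of 0]) auto
qed

lemma op_trace_A_powr:
  fixes \<phi> :: "nat \<Rightarrow> 'a::{real_inner, banach}"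
  assumes basis: "orthonormal_basis \<phi>"
  shows "op_trace \<phi> (A_powr \<phi> \<alpha> s) = (\<Sum>k. \<alpha> k powr s)"
proof -
  have "inner (A_powr \<phi> \<alpha> s (\<phi> k)) (\<phi> k) = \<alpha> k powr s" for k
  proof -
    have "summable (\<lambda>j. (\<alpha> j powr s * inner (\<phi> k) (\<phi> j))\<^sup>2)"
      by (rule summable_finite[of "{k}"]) (auto simp: orthonormal_basisD[OF basis])
    then show ?thesis
      unfolding A_powr_def by (subst fun_calc_inner[OF basis]) (simp_all add: orthonormal_basisD[OF basis])
  qed
  then show ?thesis
    by (simp add: op_trace_def)
qed

lemma X_norm_square:
  fixes \<phi> :: "nat \<Rightarrow> 'a::{real_inner, banach}"
  assumes "orthonormal_basis \<phi>" "u \<in> X_space \<phi> \<alpha> \<tau>"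
  shows "(\<lambda>k. \<alpha> k powr \<tau> * (inner u (\<phi> k))\<^sup>2) sums (X_norm \<phi> \<alpha> \<tau> u)\<^sup>2"
proof -
  have eq: "(\<alpha> k powr (\<tau> / 2) * inner u (\<phi> k))\<^sup>2 = \<alpha> k powr \<tau> * (inner u (\<phi> k))\<^sup>2" for k
    by (simp add: power_mult_distrib power2_eq_square flip: powr_add)
  have "summable (\<lambda>k. (\<alpha> k powr (\<tau> / 2) * inner u (\<phi> k))\<^sup>2)"
    using assms(2) unfolding eq by (simp add: X_space_def)
  from orthonormal_series_norm[OF assms(1) this] this show ?thesis
    by (simp add: X_norm_def A_powr_def fun_calc_def eq summable_sums)
qed

section \<open>Summability of eigenvalue sequences\<close>

text \<open>The exponential beats every power, so the terms are bounded by a constant times the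
  summable \<open>\<alpha> k powr - \<tau>\<close>. The factor 2 in the exponent is the one produced
  by squaring \<open>exp (- \<alpha> k)\<close>.\<close>

lemma summable_powr_exp:
  assumes lim: "filterlim \<alpha> at_top sequentially" and pos: "\<And>k. \<alpha> k > (0::real)"
    and summ: "summable (\<lambda>k. \<alpha> k powr - \<tau>)"
  shows "summable (\<lambda>k::nat. \<alpha> k powr p * exp (- 2 * \<alpha> k))"
proof -
  have "((\<lambda>t::real. t powr (p + \<tau>) * exp (- 2 * t)) \<longlongrightarrow> 0) at_top"
    by real_asymp
  from filterlim_compose[OF this lim]
  have "Bseq (\<lambda>k. \<alpha> k powr (p + \<tau>) * exp (- 2 * \<alpha> k))"
    by (intro convergent_imp_Bseq) (auto simp: convergent_def)
  then obtain K where K: "\<And>k. \<alpha> k powr (p + \<tau>) * exp (- 2 * \<alpha> k) \<le> K"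
    by (auto simp: Bseq_def)
  have "\<alpha> k powr p * exp (- 2 * \<alpha> k) \<le> K * \<alpha> k powr - \<tau>" for k
    using mult_right_mono[OF K[of k], of "\<alpha> k powr - \<tau>"] pos[of k]
    by (simp add: powr_add powr_minus field_simps)
  then show ?thesis
    by (intro summable_comparison_test'[OF summable_mult[OF summ, of K], of 0]) auto
qed

text \<open>Comparison with a p-series of exponent \<open>s * 2 / real d\<close>, which exceeds 1
  exactly when \<open>s > real d / 2\<close>.\<close>

lemma summable_eigenvalue_powr:
  fixes d :: nat
  assumes "c > 0" "d \<ge> 1" and ge: "\<And>k. c * real (Suc k) powr (2 / real d) \<le> \<alpha> k"
    and s: "s > real d / 2"
  shows "summable (\<lambda>k. \<alpha> k powr - s)"
proof (rule summable_comparison_test'[of _ 0])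
  have "s * 2 / real d > 1"
    using assms by (simp add: field_simps)
  then have "summable (\<lambda>k. real (Suc k) powr - (s * 2 / real d))"
    by (subst summable_Suc_iff) (simp add: summable_real_powr_iff)
  then show "summable (\<lambda>k. c powr - s * real (Suc k) powr - (s * 2 / real d))"
    by (rule summable_mult)
  show "norm (\<alpha> k powr - s) \<le> c powr - s * real (Suc k) powr - (s * 2 / real d)" for k
  proof -
    have "\<alpha> k powr - s \<le> (c * real (Suc k) powr (2 / real d)) powr - s"
      using assms by (intro powr_mono2' ge) auto
    also have "\<dots> = c powr - s * real (Suc k) powr - (s * 2 / real d)"
      using assms by (simp add: powr_mult powr_powr mult.commute)
    finally show ?thesis by simp
  qed
qed

section \<open>Laplace measures\<close>

text \<open>The absolute deviation from the mean is exponentially distributed with scale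
  \<open>sqrt (v / 2)\<close>. Orders 0, 1 and 2 give total mass, scale and variance.\<close>

lemma nn_integral_laplace_abs_moment:
  assumes v: "v > 0"
  shows "(\<integral>\<^sup>+x. ennreal (\<bar>x - m\<bar> ^ i) \<partial>laplace m v) = ennreal (fact i * sqrt (v / 2) ^ i)"
proof -
  define s where "s = sqrt (v / 2)"
  have s: "s > 0" using v by (simp add: s_def)
  \<comment> \<open>The part of the integrand on the positive half line:
    \<open>erlang_density 0 (1 / s)\<close> is the exponential density with rate
    \<open>1 / s\<close>, zero for negative arguments.\<close>
  define h where "h x = ennreal (erlang_density 0 (1 / s) x * x ^ i / 2)" for x
  have h_measurable[measurable]: "h \<in> borel_measurable borel"
    unfolding h_def by measurable
  have h: "(\<integral>\<^sup>+x. h x \<partial>lborel) = ennreal (fact i * s ^ i / 2)"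
  proof -
    have "h x = ennreal (1 / 2) * ennreal (erlang_density 0 (1 / s) x * x ^ i)" for x
      unfolding h_def by (subst ennreal_mult'[symmetric]) simp_all
    then have "(\<integral>\<^sup>+x. h x \<partial>lborel) = ennreal (1 / 2) * ennreal (fact i * s ^ i)"
      using nn_integral_erlang_ith_moment[of "1 / s" 0 i] s
      by (simp add: nn_integral_cmult power_divide)
    also have "\<dots> = ennreal (fact i * s ^ i / 2)"
      by (subst ennreal_mult'[symmetric]) simp_all
    finally show ?thesis .
  qed
  have "(\<integral>\<^sup>+x. ennreal (\<bar>x - m\<bar> ^ i) \<partial>laplace m v)
      = (\<integral>\<^sup>+x. ennreal (exp (- \<bar>x - m\<bar> / s) / (2 * s)) * ennreal (\<bar>x - m\<bar> ^ i) \<partial>lborel)"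
    unfolding laplace_def by (subst nn_integral_density) (simp_all add: laplace_density_def s_def)
  also have "\<dots> = (\<integral>\<^sup>+x. ennreal (exp (- \<bar>x\<bar> / s) / (2 * s)) * ennreal (\<bar>x\<bar> ^ i) \<partial>lborel)"
    by (subst nn_integral_real_affine[where c = 1 and t = m]) simp_all
  also have "\<dots> = (\<integral>\<^sup>+x. h x + h (0 + (- 1) * x) \<partial>lborel)"
  proof (rule nn_integral_cong_AE)
    \<comment> \<open>At 0 both reflected copies of \<open>h\<close> contribute, which doubles the
      value for \<open>i = 0\<close>; the identity holds off this null point.\<close>
    show "AE x in lborel. ennreal (exp (- \<bar>x\<bar> / s) / (2 * s)) * ennreal (\<bar>x\<bar> ^ i)
        = h x + h (0 + (- 1) * x)"
      using AE_lborel_singleton[of "0::real"]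
    proof eventually_elim
      case (elim x)
      then show ?case
        using s by (cases "x < 0")
          (auto simp: h_def erlang_density_def field_simps simp flip: ennreal_mult')
    qed
  qed
  also have "\<dots> = (\<integral>\<^sup>+x. h x \<partial>lborel) + (\<integral>\<^sup>+x. h (0 + (- 1) * x) \<partial>lborel)"
    by (rule nn_integral_add) measurable
  also have "(\<integral>\<^sup>+x. h (0 + (- 1) * x) \<partial>lborel) = (\<integral>\<^sup>+x. h x \<partial>lborel)"
    using nn_integral_real_affine[of h "- 1" 0] by simp
  also have "(\<integral>\<^sup>+x. h x \<partial>lborel) + (\<integral>\<^sup>+x. h x \<partial>lborel) = ennreal (fact i * s ^ i)"
    using s by (simp add: h flip: ennreal_plus)
  finally show ?thesis by (simp add: s_def)
qed

lemma sets_laplace[measurable_cong, simp]: "sets (laplace m v) = sets borel"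
  by (simp add: laplace_def)

lemma prob_space_laplace: "v > 0 \<Longrightarrow> prob_space (laplace m v)"
  using nn_integral_laplace_abs_moment[of v m 0] by (intro prob_spaceI) simp

text \<open>Almost surely the coordinate \<open>k\<close> of the random series is
  \<open>\<xi> k\<close>, and the mean absolute deviation of a Laplace variable is its
  scale.\<close>

lemma nn_integral_laplace_measure_coordinate:
  fixes \<phi> :: "nat \<Rightarrow> 'a::{real_inner, banach, second_countable_topology}"
  assumes basis: "orthonormal_basis \<phi>" and pos: "\<And>k. \<alpha> k > 0" and b: "b > 0"
    and summ: "summable (\<lambda>k. \<alpha> k powr - \<beta>)"
  shows "(\<integral>\<^sup>+x. ennreal \<bar>inner x (\<phi> k) - inner a (\<phi> k)\<bar> \<partial>laplace_measure \<phi> \<alpha> a b \<beta>)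
    = ennreal (b * \<alpha> k powr (- \<beta> / 2) / sqrt 2)"
proof -
  define L where "L k = laplace (inner a (\<phi> k)) (b\<^sup>2 * \<alpha> k powr - \<beta>)" for k
  define P where "P = PiM UNIV L"
  have v: "b\<^sup>2 * \<alpha> k powr - \<beta> > 0" for k
    using pos[of k] b by simp
  have sets_L[measurable_cong]: "sets (L k) = sets borel" for k
    by (simp add: L_def)
  have sets_P[measurable_cong]: "sets P = sets (PiM UNIV (\<lambda>_. borel))"
    unfolding P_def by (intro sets_PiM_cong) (auto simp: sets_L)
  have coord: "(\<integral>\<^sup>+\<xi>. ennreal (\<bar>\<xi> k - inner a (\<phi> k)\<bar> ^ i) \<partial>P)
      = ennreal (fact i * sqrt (b\<^sup>2 * \<alpha> k powr - \<beta> / 2) ^ i)" for k i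
  proof -
    have "(\<integral>\<^sup>+\<xi>. ennreal (\<bar>\<xi> k - inner a (\<phi> k)\<bar> ^ i) \<partial>P)
        = (\<integral>\<^sup>+x. ennreal (\<bar>x - inner a (\<phi> k)\<bar> ^ i) \<partial>distr P (L k) (\<lambda>\<xi>. \<xi> k))"
      by (subst nn_integral_distr) simp_all
    also have "distr P (L k) (\<lambda>\<xi>. \<xi> k) = L k"
      unfolding P_def by (rule distr_PiM_component) (simp_all add: L_def prob_space_laplace v)
    finally show ?thesis
      by (simp add: L_def nn_integral_laplace_abs_moment[OF v])
  qed
  \<comment> \<open>The moment of order 2 is the variance, so the expected sum of squared deviations
    is the trace of the covariance, finite by \<open>summ\<close>.\<close>
  have "(\<integral>\<^sup>+\<xi>. (\<Sum>k. ennreal (\<bar>\<xi> k - inner a (\<phi> k)\<bar> ^ 2)) \<partial>P)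
      = (\<Sum>k. ennreal (b\<^sup>2 * \<alpha> k powr - \<beta>))"
  proof (subst nn_integral_suminf)
    show "(\<Sum>k. \<integral>\<^sup>+\<xi>. ennreal (\<bar>\<xi> k - inner a (\<phi> k)\<bar> ^ 2) \<partial>P)
        = (\<Sum>k. ennreal (b\<^sup>2 * \<alpha> k powr - \<beta>))"
      unfolding coord using v by (simp add: less_imp_le)
  qed measurable
  also have "\<dots> = ennreal (\<Sum>k. b\<^sup>2 * \<alpha> k powr - \<beta>)"
    by (intro suminf_ennreal2 summable_mult summ) simp
  finally have "AE \<xi> in P. (\<Sum>k. ennreal (\<bar>\<xi> k - inner a (\<phi> k)\<bar> ^ 2)) \<noteq> \<infinity>"
    by (intro nn_integral_PInf_AE) auto
  text \<open>
    The series defining the measure converges only almost surely, by the second moments; elsewhere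
    its value is junk and says nothing about \<open>\<xi> k\<close>.
  \<close>
  then have "AE \<xi> in P. inner (\<Sum>k. \<xi> k *\<^sub>R \<phi> k) (\<phi> k) = \<xi> k"
  proof eventually_elim
    case (elim \<xi>)
    then have "summable (\<lambda>k. \<bar>\<xi> k - inner a (\<phi> k)\<bar> ^ 2)"
      by (intro summable_suminf_not_top) auto
    then have "summable (\<lambda>k. 2 * \<bar>\<xi> k - inner a (\<phi> k)\<bar> ^ 2 + 2 * (inner a (\<phi> k))\<^sup>2)"
      by (intro summable_add summable_mult bessel_summable[OF basis])
    then have "summable (\<lambda>k. (\<xi> k)\<^sup>2)"
    proof (rule summable_comparison_test'[of _ 0])
      fix n
      \<comment> \<open>This square is the difference of the two sides of the inequality to be
        shown.\<close>
      have "0 \<le> (\<xi> n - 2 * inner a (\<phi> n))\<^sup>2" by simp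
      then show "norm ((\<xi> n)\<^sup>2) \<le> 2 * \<bar>\<xi> n - inner a (\<phi> n)\<bar> ^ 2 + 2 * (inner a (\<phi> n))\<^sup>2"
        by (simp add: power2_eq_square algebra_simps)
    qed
    then show ?case
      by (rule orthonormal_series_inner[OF basis])
  qed
  then have "(\<integral>\<^sup>+\<xi>. ennreal \<bar>inner (\<Sum>k. \<xi> k *\<^sub>R \<phi> k) (\<phi> k) - inner a (\<phi> k)\<bar> \<partial>P)
      = (\<integral>\<^sup>+\<xi>. ennreal (\<bar>\<xi> k - inner a (\<phi> k)\<bar> ^ 1) \<partial>P)"
    by (intro nn_integral_cong_AE) auto
  also have "\<dots> = ennreal (b * \<alpha> k powr (- \<beta> / 2) / sqrt 2)"
    unfolding coord using b pos[of k] powr_half_sqrt_powr[of "\<alpha> k" "- \<beta>"]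
    by (simp add: real_sqrt_mult real_sqrt_divide)
  finally show ?thesis
    unfolding laplace_measure_def L_def[symmetric] P_def[symmetric]
    by (subst nn_integral_distr) (simp_all add: borel_measurable_suminf)
qed


section \<open>The estimator as a coordinatewise truncation\<close>

definition clip :: "real \<Rightarrow> real \<Rightarrow> real" where
  "clip R z = max (- R) (min R z)"

text \<open>The function on the right is strongly convex in \<open>u\<close> with modulus
  \<open>p\<close>. The quadratic growth term on the left records this and yields minimality and
  uniqueness at once.\<close>

lemma clip_minimizes:
  assumes p: "p > 0" and R: "R \<ge> 0"
  shows "p * R * \<bar>z - clip R z\<bar> + p / 2 * (clip R z)\<^sup>2 + p / 2 * (u - clip R z)\<^sup>2
    \<le> p * R * \<bar>z - u\<bar> + p / 2 * u\<^sup>2"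
proof -
  have "R * \<bar>z - clip R z\<bar> + (clip R z)\<^sup>2 / 2 + (u - clip R z)\<^sup>2 / 2 \<le> R * \<bar>z - u\<bar> + u\<^sup>2 / 2"
  proof -
    consider "z > R" | "z < - R" | "\<bar>z\<bar> \<le> R" by linarith
    then show ?thesis
    proof cases
      case 1
      \<comment> \<open>Here the truncation is \<open>R\<close>, and the left side collapses to
        \<open>R * (z - u) + u\<^sup>2 / 2\<close>; the case below \<open>- R\<close> is its mirror
        image.\<close>
      have "R * (z - u) \<le> R * \<bar>z - u\<bar>"
        using R by (intro mult_left_mono) auto
      with 1 R show ?thesis
        by (simp add: clip_def power2_eq_square algebra_simps add_divide_distrib diff_divide_distrib)
    next
      case 2
      have "R * (u - z) \<le> R * \<bar>z - u\<bar>"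
        using R by (intro mult_left_mono) auto
      with 2 R show ?thesis
        by (simp add: clip_def power2_eq_square algebra_simps add_divide_distrib diff_divide_distrib)
    next
      case 3
      then have "clip R z = z"
        by (auto simp: clip_def)
      \<comment> \<open>With no truncation the left side is
        \<open>z * (z - u) + u\<^sup>2 / 2\<close>.\<close>
      moreover have "z * (z - u) \<le> R * \<bar>z - u\<bar>"
        using mult_right_mono[OF 3, of "\<bar>z - u\<bar>"] abs_le_D1[of "z * (z - u)"] by (simp add: abs_mult)
      ultimately show ?thesis
        by (simp add: power2_eq_square algebra_simps add_divide_distrib diff_divide_distrib)
    qed
  qed
  from mult_left_mono[OF this, of p] p show ?thesis
    by (simp add: algebra_simps)
qed

text \<open>Truncation fixes \<open>v\<close> and is nonexpansive, so the error is at most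
  \<open>\<bar>z - v\<bar>\<close>; both points lie in an interval of length \<open>2 * R\<close>.
  The product of the two bounds is linear in \<open>\<bar>z - v\<bar>\<close>, so a first moment
  controls the mean square.\<close>

lemma clip_error:
  assumes "\<bar>v\<bar> \<le> R"
  shows "(clip R z - v)\<^sup>2 \<le> 2 * R * \<bar>z - v\<bar>"
proof -
  have "\<bar>clip R z - v\<bar> * \<bar>clip R z - v\<bar> \<le> 2 * R * \<bar>z - v\<bar>"
    using assms by (intro mult_mono) (auto simp: clip_def)
  then show ?thesis
    by (simp add: power2_eq_square)
qed

lemma abs_clip_le: "R \<ge> 0 \<Longrightarrow> \<bar>clip R z\<bar> \<le> R"
  by (auto simp: clip_def)

text \<open>The solution \<open>R\<close> of
  \<open>p * R = sqrt 2 * exp (- t) / (b * t powr (- \<beta> / 2))\<close> with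
  \<open>p = t powr \<tau> / r\<^sup>2\<close>: the weight of the data term relative to that of the
  prior.\<close>

definition MAP_radius :: "real \<Rightarrow> real \<Rightarrow> real \<Rightarrow> real \<Rightarrow> real \<Rightarrow> real" where
  "MAP_radius b \<beta> r \<tau> t = sqrt 2 * r\<^sup>2 * exp (- t) * t powr (\<beta> / 2 - \<tau>) / b"

text \<open>
  Multiplying the coordinate functional by \<open>exp t\<close> inside the absolute value turns it into
  \<open>p * R * \<bar>z - v\<bar> + p / 2 * v\<^sup>2\<close>, up to a constant, with \<open>p = t powr \<tau> / r\<^sup>2\<close> and \<open>z = exp t * Y\<close>.
\<close>

lemma clip_minimizes_coordinate:
  fixes t b r \<beta> \<tau> Y v :: real
  assumes t: "t > 0" and b: "b > 0" and r: "r > 0"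
  defines "g \<equiv> \<lambda>v. sqrt 2 * ((\<bar>Y - exp (- t) * v\<bar> - \<bar>Y\<bar>) / (b * t powr (- \<beta> / 2)))
      + 1 / (2 * r\<^sup>2) * (t powr \<tau> * v\<^sup>2)"
    and "c \<equiv> clip (MAP_radius b \<beta> r \<tau> t) (exp t * Y)"
  shows "g c + 1 / (2 * r\<^sup>2) * (t powr \<tau> * (v - c)\<^sup>2) \<le> g v"
proof -
  define p where "p = t powr \<tau> / r\<^sup>2"
  define R where "R = MAP_radius b \<beta> r \<tau> t"
  have pR: "p > 0" "R \<ge> 0"
    using assms by (auto simp: p_def R_def MAP_radius_def)
  have "p * R = sqrt 2 * exp (- t) / b * (t powr \<tau> * t powr (\<beta> / 2 - \<tau>))"
    using r by (simp add: p_def R_def MAP_radius_def)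
  also have "t powr \<tau> * t powr (\<beta> / 2 - \<tau>) = 1 / t powr (- \<beta> / 2)"
    using t by (simp add: powr_minus field_simps flip: powr_add)
  finally have K: "p * R = sqrt 2 * exp (- t) / (b * t powr (- \<beta> / 2))"
    by simp
  have g: "g u = p * R * \<bar>exp t * Y - u\<bar> + p / 2 * u\<^sup>2 - sqrt 2 * \<bar>Y\<bar> / (b * t powr (- \<beta> / 2))" for u
  proof -
    have "\<bar>Y - exp (- t) * u\<bar> = exp (- t) * \<bar>exp t * Y - u\<bar>"
      using abs_mult[of "exp (- t)" "exp t * Y - u"]
      by (simp add: right_diff_distrib flip: mult.assoc exp_add)
    then show ?thesis
      unfolding g_def K by (simp add: p_def diff_divide_distrib right_diff_distrib)
  qed
  show ?thesis
    using clip_minimizes[OF pR, of "exp t * Y" v] unfolding g c_def R_def[symmetric]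
    by (simp add: p_def)
qed

text \<open>Subtracting \<open>\<bar>inner y (\<phi> k)\<bar>\<close> makes the data series
  converge: the reverse triangle inequality bounds each numerator by
  \<open>exp (- \<alpha> k) * \<bar>inner u (\<phi> k)\<bar>\<close>, whatever \<open>y\<close>
  is.\<close>

lemma objective_sums:
  fixes \<phi> :: "nat \<Rightarrow> 'a::{real_inner, banach}"
  assumes basis: "orthonormal_basis \<phi>" and pos: "\<And>k. \<alpha> k > 0" and b: "b > 0"
    and summ: "summable (\<lambda>k. \<alpha> k powr \<beta> * exp (- 2 * \<alpha> k))"
    and u: "u \<in> X_space \<phi> \<alpha> \<tau>"
  shows "(\<lambda>k. sqrt 2 * ((\<bar>inner y (\<phi> k) - exp (- \<alpha> k) * inner u (\<phi> k)\<bar> - \<bar>inner y (\<phi> k)\<bar>)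
        / (b * \<alpha> k powr (- \<beta> / 2))) + 1 / (2 * r\<^sup>2) * (\<alpha> k powr \<tau> * (inner u (\<phi> k))\<^sup>2))
    sums (Phi \<phi> \<alpha> b \<beta> u y + 1 / (2 * r\<^sup>2) * (X_norm \<phi> \<alpha> \<tau> u)\<^sup>2)"
  unfolding Phi_def
proof (intro sums_add sums_mult X_norm_square[OF basis u] summable_sums)
  let ?Y = "\<lambda>k. inner y (\<phi> k)" and ?u = "\<lambda>k. inner u (\<phi> k)"
  have "summable (\<lambda>k. (\<alpha> k powr \<beta> * exp (- 2 * \<alpha> k) + (?u k)\<^sup>2) / b)"
    by (intro summable_divide summable_add summ bessel_summable[OF basis])
  then show "summable (\<lambda>k. (\<bar>?Y k - exp (- \<alpha> k) * ?u k\<bar> - \<bar>?Y k\<bar>) / (b * \<alpha> k powr (- \<beta> / 2)))"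
  proof (rule summable_comparison_test'[of _ 0])
    fix k
    \<comment> \<open>The weighted term is at most \<open>q * \<bar>?u k\<bar> / b\<close>, a
      product of two square-summable sequences over \<open>b\<close>.\<close>
    define q where "q = \<alpha> k powr (\<beta> / 2) * exp (- \<alpha> k)"
    have q: "q \<ge> 0" "q\<^sup>2 = \<alpha> k powr \<beta> * exp (- 2 * \<alpha> k)"
      by (simp_all add: q_def power2_eq_square flip: powr_add exp_add)
        (simp add: ac_simps flip: powr_add exp_add)
    have "\<bar>\<bar>?Y k - exp (- \<alpha> k) * ?u k\<bar> - \<bar>?Y k\<bar>\<bar> \<le> exp (- \<alpha> k) * \<bar>?u k\<bar>"
      using abs_triangle_ineq3[of "?Y k - exp (- \<alpha> k) * ?u k" "?Y k"] by (simp add: abs_mult)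
    then have "norm ((\<bar>?Y k - exp (- \<alpha> k) * ?u k\<bar> - \<bar>?Y k\<bar>) / (b * \<alpha> k powr (- \<beta> / 2)))
        \<le> exp (- \<alpha> k) * \<bar>?u k\<bar> / (b * \<alpha> k powr (- \<beta> / 2))"
      using b by (auto simp: abs_mult intro!: divide_right_mono)
    also have "\<dots> = q * \<bar>?u k\<bar> / b"
      using pos[of k] by (simp add: q_def powr_minus field_simps)
    also have "\<dots> \<le> (q\<^sup>2 + (?u k)\<^sup>2) / b"
    proof (rule divide_right_mono)
      have "2 * q * \<bar>?u k\<bar> \<le> q\<^sup>2 + \<bar>?u k\<bar>\<^sup>2"
        by (rule sum_squares_bound)
      moreover have "0 \<le> q * \<bar>?u k\<bar>"
        using q by simp
      ultimately show "q * \<bar>?u k\<bar> \<le> q\<^sup>2 + (?u k)\<^sup>2"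
        by simp
    qed (use b in simp)
    finally show "norm ((\<bar>?Y k - exp (- \<alpha> k) * ?u k\<bar> - \<bar>?Y k\<bar>) / (b * \<alpha> k powr (- \<beta> / 2)))
        \<le> (\<alpha> k powr \<beta> * exp (- 2 * \<alpha> k) + (?u k)\<^sup>2) / b"
      by (simp only: q)
  qed
qed

text \<open>The radii decay like \<open>exp (- \<alpha> k)\<close> up to a power. Exponent
  \<open>s = 0\<close> puts sequences dominated by them in \<open>X\<close>, and
  \<open>s = \<tau>\<close> puts them in the prior space.\<close>

lemma summable_MAP_radius:
  assumes pos: "\<And>k. \<alpha> k > 0" and b: "b > 0" and summ: "\<And>p. summable (\<lambda>k. \<alpha> k powr p * exp (- 2 * \<alpha> k))"
  shows "summable (\<lambda>k::nat. \<alpha> k powr s * (MAP_radius b \<beta> r \<tau> (\<alpha> k))\<^sup>2)"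
proof -
  have "\<alpha> k powr s * (MAP_radius b \<beta> r \<tau> (\<alpha> k))\<^sup>2
      = 2 * r ^ 4 / b\<^sup>2 * (\<alpha> k powr (s + (\<beta> - 2 * \<tau>)) * exp (- 2 * \<alpha> k))" for k
  proof -
    have "(MAP_radius b \<beta> r \<tau> (\<alpha> k))\<^sup>2
        = 2 * r ^ 4 / b\<^sup>2 * ((\<alpha> k powr (\<beta> / 2 - \<tau>))\<^sup>2 * (exp (- \<alpha> k))\<^sup>2)"
      by (simp add: MAP_radius_def power_mult_distrib power_divide flip: power_mult)
    also have "(\<alpha> k powr (\<beta> / 2 - \<tau>))\<^sup>2 = \<alpha> k powr (\<beta> - 2 * \<tau>)"
      by (simp add: power2_eq_square flip: powr_add)
    also have "(exp (- \<alpha> k))\<^sup>2 = exp (- 2 * \<alpha> k)"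
      by (simp add: power2_eq_square flip: exp_add)
    finally show ?thesis
      by (simp add: powr_add)
  qed
  then show ?thesis
    by (simp only:) (intro summable_mult summ)
qed

text \<open>The coordinatewise minimizers form a vector of \<open>X_space\<close> because the radii
  decay, and summing the scalar inequalities makes it the unique minimizer. The choice hidden in
  \<open>arg_min_on\<close> must therefore return it.\<close>

lemma u_MAP_inner:
  fixes \<phi> :: "nat \<Rightarrow> 'a::{real_inner, banach}"
  assumes basis: "orthonormal_basis \<phi>" and pos: "\<And>k. \<alpha> k > 0" and b: "b > 0" and r: "r > 0"
    and summ: "\<And>p. summable (\<lambda>k. \<alpha> k powr p * exp (- 2 * \<alpha> k))"
  shows "inner (u_MAP \<phi> \<alpha> b \<beta> r \<tau> y) (\<phi> k)
    = clip (MAP_radius b \<beta> r \<tau> (\<alpha> k)) (exp (\<alpha> k) * inner y (\<phi> k))"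
proof -
  define c where "c k = clip (MAP_radius b \<beta> r \<tau> (\<alpha> k)) (exp (\<alpha> k) * inner y (\<phi> k))" for k
  define J where "J u = Phi \<phi> \<alpha> b \<beta> u y + 1 / (2 * r\<^sup>2) * (X_norm \<phi> \<alpha> \<tau> u)\<^sup>2" for u
  define g where "g k v = sqrt 2 * ((\<bar>inner y (\<phi> k) - exp (- \<alpha> k) * v\<bar> - \<bar>inner y (\<phi> k)\<bar>)
        / (b * \<alpha> k powr (- \<beta> / 2))) + 1 / (2 * r\<^sup>2) * (\<alpha> k powr \<tau> * v\<^sup>2)" for k v
  have J: "(\<lambda>k. g k (inner u (\<phi> k))) sums J u" if "u \<in> X_space \<phi> \<alpha> \<tau>" for u
    unfolding g_def J_def by (rule objective_sums[OF basis pos b summ that])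
  have g: "g k (c k) + 1 / (2 * r\<^sup>2) * (\<alpha> k powr \<tau> * (v - c k)\<^sup>2) \<le> g k v" for k v
    unfolding g_def c_def by (rule clip_minimizes_coordinate[OF pos b r])
  have summable_c: "summable (\<lambda>k. \<alpha> k powr s * (c k)\<^sup>2)" for s
  proof (rule summable_comparison_test'[OF summable_MAP_radius[OF pos b summ], of 0])
    show "norm (\<alpha> k powr s * (c k)\<^sup>2) \<le> \<alpha> k powr s * (MAP_radius b \<beta> r \<tau> (\<alpha> k))\<^sup>2" for k
    proof -
      have "MAP_radius b \<beta> r \<tau> (\<alpha> k) \<ge> 0"
        using b by (simp add: MAP_radius_def)
      then show ?thesis
        using abs_clip_le by (auto simp: c_def abs_le_square_iff[symmetric] intro!: mult_left_mono)
    qed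
  qed
  define x where "x = (\<Sum>k. c k *\<^sub>R \<phi> k)"
  have "\<alpha> k powr 0 = 1" for k
    using pos[of k] by simp
  then have x: "inner x (\<phi> k) = c k" for k
    unfolding x_def using summable_c[of 0] by (intro orthonormal_series_inner[OF basis]) simp
  have x_in: "x \<in> X_space \<phi> \<alpha> \<tau>"
    using summable_c by (simp add: X_space_def x)
  \<comment> \<open>The nonnegative growth terms sum to at most \<open>J u - J x\<close>, which is
    at most 0, so all of them vanish.\<close>
  have arg_min_unique: "u = x" if u: "u \<in> X_space \<phi> \<alpha> \<tau>" and le: "J u \<le> J x" for u
  proof (rule orthonormal_basis_eqI[OF basis])
    fix k
    let ?e = "\<lambda>k. 1 / (2 * r\<^sup>2) * (\<alpha> k powr \<tau> * (inner u (\<phi> k) - c k)\<^sup>2)"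
    have diff: "(\<lambda>k. g k (inner u (\<phi> k)) - g k (c k)) sums (J u - J x)"
      using sums_diff[OF J[OF u] J[OF x_in]] by (simp add: x)
    have le_diff: "?e k \<le> g k (inner u (\<phi> k)) - g k (c k)" for k
      using g[of k "inner u (\<phi> k)"] by linarith
    have nonneg: "?e k \<ge> 0" for k
      by simp
    have summ_e: "summable ?e"
      using nonneg le_diff by (intro summable_comparison_test'[OF sums_summable[OF diff], of 0]) simp
    have "suminf ?e \<le> J u - J x"
      using suminf_le[OF le_diff summ_e sums_summable[OF diff]] sums_unique[OF diff] by simp
    then have "suminf ?e = 0"
      using le suminf_nonneg[OF summ_e nonneg] by linarith
    then have "?e k = 0"
      using suminf_eq_zero_iff[OF summ_e nonneg] by blast
    then show "inner u (\<phi> k) = inner x (\<phi> k)"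
      using r pos[of k] by (simp add: x)
  qed
  \<comment> \<open>Otherwise \<open>J u < J x\<close>, and \<open>arg_min_unique\<close> would
    force \<open>u = x\<close>.\<close>
  have "J x \<le> J u" if u: "u \<in> X_space \<phi> \<alpha> \<tau>" for u
    using arg_min_unique[OF u] by force
  then have "is_arg_min J (\<lambda>u. u \<in> X_space \<phi> \<alpha> \<tau>) x"
    using x_in by (simp add: is_arg_min_linorder)
  then have "is_arg_min J (\<lambda>u. u \<in> X_space \<phi> \<alpha> \<tau>) (u_MAP \<phi> \<alpha> b \<beta> r \<tau> y)"
    unfolding u_MAP_def arg_min_on_def arg_min_def J_def[symmetric] by (rule someI)
  then have "u_MAP \<phi> \<alpha> b \<beta> r \<tau> y = x"
    using arg_min_unique x_in by (simp add: is_arg_min_linorder)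
  then show ?thesis
    by (simp add: x c_def)
qed

text \<open>The coordinates of \<open>u_dagger\<close> and the radii share the factor
  \<open>\<alpha> k powr (\<beta> / 2 - \<tau>) * exp (- \<alpha> k)\<close>, so the claim reduces
  to \<open>\<bar>inner w (\<phi> k)\<bar> \<le> sqrt 2 * r\<^sup>2 / b\<close>.\<close>

lemma source_condition_bound:
  fixes \<phi> :: "nat \<Rightarrow> 'a::{real_inner, banach}"
  assumes basis: "orthonormal_basis \<phi>" and pos: "\<And>k. \<alpha> k > 0" and b: "b > 0"
    and summ: "\<And>p. summable (\<lambda>k. \<alpha> k powr p * exp (- 2 * \<alpha> k))"
    and w: "\<And>k. \<bar>inner w (\<phi> k)\<bar> \<le> \<rho>" and r: "\<rho> / sqrt 2 * b \<le> r\<^sup>2"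
  shows "\<bar>inner (A_powr \<phi> \<alpha> (\<beta> / 2 - \<tau>) (exp_neg_A \<phi> \<alpha> w)) (\<phi> k)\<bar> \<le> MAP_radius b \<beta> r \<tau> (\<alpha> k)"
proof -
  let ?s = "\<beta> / 2 - \<tau>"
  have w': "inner (exp_neg_A \<phi> \<alpha> w) (\<phi> k) = exp (- \<alpha> k) * inner w (\<phi> k)" for k
    by (rule exp_neg_A_inner[OF basis pos])
  have bound: "\<bar>\<alpha> k powr ?s * (exp (- \<alpha> k) * inner w (\<phi> k))\<bar> \<le> MAP_radius b \<beta> r \<tau> (\<alpha> k)" for k
  proof -
    have "\<rho> \<le> sqrt 2 * r\<^sup>2 / b"
    proof -
      have "\<rho> = sqrt 2 * (\<rho> / sqrt 2 * b) / b"
        using b by simp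
      also have "\<dots> \<le> sqrt 2 * r\<^sup>2 / b"
        using r b by (intro divide_right_mono mult_left_mono) auto
      finally show ?thesis .
    qed
    then have "\<bar>inner w (\<phi> k)\<bar> \<le> sqrt 2 * r\<^sup>2 / b"
      using w[of k] by linarith
    from mult_left_mono[OF this, of "\<alpha> k powr ?s * exp (- \<alpha> k)"] show ?thesis
      by (simp add: MAP_radius_def abs_mult ac_simps)
  qed
  have "\<alpha> k powr 0 = 1" for k
    using pos[of k] by simp
  \<comment> \<open>Domination by the radii also shows that
    \<open>exp_neg_A \<phi> \<alpha> w\<close> lies in the domain of the power of
    \<open>A\<close>.\<close>
  then have "summable (\<lambda>k. (MAP_radius b \<beta> r \<tau> (\<alpha> k))\<^sup>2)"
    using summable_MAP_radius[OF pos b summ, of 0] by simp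
  then have "summable (\<lambda>k. (\<alpha> k powr ?s * inner (exp_neg_A \<phi> \<alpha> w) (\<phi> k))\<^sup>2)"
  proof (rule summable_comparison_test'[of _ 0])
    show "norm ((\<alpha> k powr ?s * inner (exp_neg_A \<phi> \<alpha> w) (\<phi> k))\<^sup>2) \<le> (MAP_radius b \<beta> r \<tau> (\<alpha> k))\<^sup>2" for k
      using power_mono[OF bound[of k] abs_ge_zero, of 2] unfolding w' by simp
  qed
  then show ?thesis
    unfolding A_powr_def using bound[of k] by (subst fun_calc_inner[OF basis]) (simp_all add: w')
qed

section \<open>The error bound\<close>

text \<open>Integrability is part of the claim because the Bochner integral of a non-integrable
  function is 0, which would make the bound alone empty.\<close>

theorem theorem4p7:
  fixes \<phi> :: "nat \<Rightarrow> 'a::{real_inner, banach, second_countable_topology}"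
    and d :: nat
    and Cminus Cplus r \<tau> b \<beta> \<rho> C :: real
    and \<alpha> :: "nat \<Rightarrow> real"
    and u_dagger w :: 'a
    and M :: "'w measure"
    and y :: "'w \<Rightarrow> 'a"
  assumes "orthonormal_basis \<phi>"
    and "d \<ge> 1" and "Cminus > 0" and "Cplus > 0"
    and "\<And>k. \<alpha> k > 0" and "mono \<alpha>"
    and "\<And>k. Cminus * real (Suc k) powr (2 / real d) \<le> \<alpha> k"
    and "\<And>k. \<alpha> k \<le> Cplus * real (Suc k) powr (2 / real d)"
    and "r > 0" and "\<tau> > real d / 2" and "b > 0" and "\<beta> > real d / 2"
    and "prob_space M" and "y \<in> borel_measurable M"
    and "distr M borel y = laplace_measure \<phi> \<alpha> (exp_neg_A \<phi> \<alpha> u_dagger) b \<beta>"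
    and "\<rho> > 0"
    and "u_dagger = A_powr \<phi> \<alpha> (\<beta> / 2 - \<tau>) (exp_neg_A \<phi> \<alpha> w)"
    and "(SUP k. \<bar>inner w (\<phi> k)\<bar>) \<le> \<rho>"
    and "C > 0"
    and "\<rho> / sqrt 2 * b \<le> r\<^sup>2" and "r\<^sup>2 \<le> C * b"
  shows "integrable M (\<lambda>\<omega>. (norm (u_MAP \<phi> \<alpha> b \<beta> r \<tau> (y \<omega>) - u_dagger))\<^sup>2)
    \<and> prob_space.expectation M (\<lambda>\<omega>. (norm (u_MAP \<phi> \<alpha> b \<beta> r \<tau> (y \<omega>) - u_dagger))\<^sup>2)
        \<le> 2 * C * op_trace \<phi> (A_powr \<phi> \<alpha> (- \<tau>)) * b"
proof -
  note basis = assms(1) and pos = assms(5) and lower = assms(7) and r = assms(9) and b = assms(11)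
  note y[measurable] = assms(14)
  have summ_\<tau>: "summable (\<lambda>k. \<alpha> k powr - \<tau>)" and summ_\<beta>: "summable (\<lambda>k. \<alpha> k powr - \<beta>)"
    using summable_eigenvalue_powr[OF \<open>Cminus > 0\<close> \<open>d \<ge> 1\<close> lower] assms(10,12) by blast+
  have "filterlim (\<lambda>k. Cminus * real (Suc k) powr (2 / real d)) at_top sequentially"
    using \<open>Cminus > 0\<close> \<open>d \<ge> 1\<close> by real_asymp
  then have "filterlim \<alpha> at_top sequentially"
    by (rule filterlim_at_top_mono) (intro always_eventually allI lower)
  note summ = summable_powr_exp[OF this pos summ_\<tau>]
  have "\<bar>inner w (\<phi> k)\<bar> \<le> \<rho>" for k
  proof -
    \<comment> \<open>A real supremum dominates its family only for bounded families; Cauchy-Schwarz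
      with unit vectors supplies the bound \<open>norm w\<close>.\<close>
    have "bdd_above (range (\<lambda>k. \<bar>inner w (\<phi> k)\<bar>))"
    proof (rule bdd_aboveI2)
      show "\<bar>inner w (\<phi> k)\<bar> \<le> norm w" for k
        using Cauchy_Schwarz_ineq2[of w "\<phi> k"] orthonormal_basisD[OF basis, of k k]
        by (simp add: norm_eq_sqrt_inner)
    qed
    then show ?thesis
      using cSUP_upper[of k UNIV "\<lambda>k. \<bar>inner w (\<phi> k)\<bar>"] assms(18) by simp
  qed
  then have dagger: "\<bar>inner u_dagger (\<phi> k)\<bar> \<le> MAP_radius b \<beta> r \<tau> (\<alpha> k)" for k
    unfolding \<open>u_dagger = _\<close> using source_condition_bound[OF basis pos b summ] assms(20) by blast
  let ?a = "exp_neg_A \<phi> \<alpha> u_dagger"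
  define X where "X \<omega> = u_MAP \<phi> \<alpha> b \<beta> r \<tau> (y \<omega>) - u_dagger" for \<omega>
  have X: "inner (X \<omega>) (\<phi> k) = clip (MAP_radius b \<beta> r \<tau> (\<alpha> k)) (exp (\<alpha> k) * inner (y \<omega>) (\<phi> k))
      - inner u_dagger (\<phi> k)" for \<omega> k
    by (simp add: X_def inner_diff_left u_MAP_inner[OF basis pos b r summ])
  \<comment> \<open>The estimator is defined by choice; its measurability comes from the explicit
    truncation formula, and that of the norm from Parseval.\<close>
  have X_measurable[measurable]: "(\<lambda>\<omega>. inner (X \<omega>) (\<phi> k)) \<in> borel_measurable M" for k
    unfolding X clip_def by measurable
  have norm_X: "(norm (X \<omega>))\<^sup>2 = (\<Sum>k. (inner (X \<omega>) (\<phi> k))\<^sup>2)" for \<omega>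
    by (rule parseval[OF basis])
  have [measurable]: "(\<lambda>\<omega>. (norm (X \<omega>))\<^sup>2) \<in> borel_measurable M"
    unfolding norm_X by measurable
  have coordinate: "(\<integral>\<^sup>+\<omega>. ennreal ((inner (X \<omega>) (\<phi> k))\<^sup>2) \<partial>M) \<le> ennreal (2 * r\<^sup>2 * \<alpha> k powr - \<tau>)" for k
  proof -
    let ?R = "MAP_radius b \<beta> r \<tau> (\<alpha> k)"
    have R: "?R \<ge> 0"
      using b by (simp add: MAP_radius_def)
    have "(\<integral>\<^sup>+\<omega>. ennreal ((inner (X \<omega>) (\<phi> k))\<^sup>2) \<partial>M)
        \<le> (\<integral>\<^sup>+\<omega>. ennreal (2 * ?R * exp (\<alpha> k)) * ennreal \<bar>inner (y \<omega>) (\<phi> k) - inner ?a (\<phi> k)\<bar> \<partial>M)"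
    proof (rule nn_integral_mono)
      fix \<omega>
      \<comment> \<open>Inverting \<open>exp_neg_A\<close> amplifies the noise by
        \<open>exp (\<alpha> k)\<close>; the factor \<open>exp (- \<alpha> k)\<close> inside the
        radius compensates for this.\<close>
      have "exp (\<alpha> k) * inner (y \<omega>) (\<phi> k) - inner u_dagger (\<phi> k)
          = exp (\<alpha> k) * (inner (y \<omega>) (\<phi> k) - inner ?a (\<phi> k))"
        by (simp add: exp_neg_A_inner[OF basis pos] right_diff_distrib flip: mult.assoc exp_add)
      then have "(inner (X \<omega>) (\<phi> k))\<^sup>2 \<le> 2 * ?R * exp (\<alpha> k) * \<bar>inner (y \<omega>) (\<phi> k) - inner ?a (\<phi> k)\<bar>"
        using clip_error[OF dagger, of k "exp (\<alpha> k) * inner (y \<omega>) (\<phi> k)"] by (simp add: X abs_mult)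
      then show "ennreal ((inner (X \<omega>) (\<phi> k))\<^sup>2)
          \<le> ennreal (2 * ?R * exp (\<alpha> k)) * ennreal \<bar>inner (y \<omega>) (\<phi> k) - inner ?a (\<phi> k)\<bar>"
        using R by (simp add: ennreal_leI flip: ennreal_mult')
    qed
    also have "\<dots> = ennreal (2 * ?R * exp (\<alpha> k))
        * (\<integral>\<^sup>+\<omega>. ennreal \<bar>inner (y \<omega>) (\<phi> k) - inner ?a (\<phi> k)\<bar> \<partial>M)"
      by (rule nn_integral_cmult) measurable
    also have "(\<integral>\<^sup>+\<omega>. ennreal \<bar>inner (y \<omega>) (\<phi> k) - inner ?a (\<phi> k)\<bar> \<partial>M)
        = (\<integral>\<^sup>+x. ennreal \<bar>inner x (\<phi> k) - inner ?a (\<phi> k)\<bar> \<partial>distr M borel y)"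
      by (subst nn_integral_distr) simp_all
    also have "\<dots> = ennreal (b * \<alpha> k powr (- \<beta> / 2) / sqrt 2)"
      unfolding assms(15) by (rule nn_integral_laplace_measure_coordinate[OF basis pos b summ_\<beta>])
    also have "ennreal (2 * ?R * exp (\<alpha> k)) * ennreal (b * \<alpha> k powr (- \<beta> / 2) / sqrt 2)
        = ennreal (2 * ?R * exp (\<alpha> k) * (b * \<alpha> k powr (- \<beta> / 2) / sqrt 2))"
      using R by (intro ennreal_mult'[symmetric]) simp
    \<comment> \<open>The factors \<open>sqrt 2\<close> and \<open>b\<close> cancel against the
      Laplace scale; the exponentials and the powers with \<open>\<beta> / 2\<close> cancel
      next.\<close>
    also have "2 * ?R * exp (\<alpha> k) * (b * \<alpha> k powr (- \<beta> / 2) / sqrt 2)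
        = 2 * r\<^sup>2 * (exp (- \<alpha> k) * exp (\<alpha> k)) * (\<alpha> k powr (\<beta> / 2 - \<tau>) * \<alpha> k powr (- \<beta> / 2))"
      using b by (simp add: MAP_radius_def)
    also have "\<dots> = 2 * r\<^sup>2 * \<alpha> k powr - \<tau>"
      by (simp flip: powr_add exp_add)
    finally show ?thesis .
  qed
  have trace: "op_trace \<phi> (A_powr \<phi> \<alpha> (- \<tau>)) = (\<Sum>k. \<alpha> k powr - \<tau>)"
    by (rule op_trace_A_powr[OF basis])
  have trace_nonneg: "(\<Sum>k. \<alpha> k powr - \<tau>) \<ge> 0"
    by (intro suminf_nonneg summ_\<tau>) simp
  have "(\<integral>\<^sup>+\<omega>. ennreal ((norm (X \<omega>))\<^sup>2) \<partial>M) = (\<integral>\<^sup>+\<omega>. (\<Sum>k. ennreal ((inner (X \<omega>) (\<phi> k))\<^sup>2)) \<partial>M)"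
    unfolding norm_X by (simp add: suminf_ennreal2 bessel_summable[OF basis])
  also have "\<dots> = (\<Sum>k. \<integral>\<^sup>+\<omega>. ennreal ((inner (X \<omega>) (\<phi> k))\<^sup>2) \<partial>M)"
    by (rule nn_integral_suminf) measurable
  also have "\<dots> \<le> (\<Sum>k. ennreal (2 * r\<^sup>2 * \<alpha> k powr - \<tau>))"
    by (intro suminf_le coordinate) auto
  also have "\<dots> = ennreal (\<Sum>k. 2 * r\<^sup>2 * \<alpha> k powr - \<tau>)"
    by (intro suminf_ennreal2 summable_mult summ_\<tau>) simp
  also have "(\<Sum>k. 2 * r\<^sup>2 * \<alpha> k powr - \<tau>) = 2 * r\<^sup>2 * (\<Sum>k. \<alpha> k powr - \<tau>)"
    by (rule suminf_mult[OF summ_\<tau>])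
  also have "\<dots> \<le> 2 * (C * b) * (\<Sum>k. \<alpha> k powr - \<tau>)"
    using assms(21) trace_nonneg by (intro mult_right_mono) auto
  also have "\<dots> = 2 * C * op_trace \<phi> (A_powr \<phi> \<alpha> (- \<tau>)) * b"
    by (simp add: trace)
  finally have bound: "(\<integral>\<^sup>+\<omega>. ennreal ((norm (X \<omega>))\<^sup>2) \<partial>M)
      \<le> ennreal (2 * C * op_trace \<phi> (A_powr \<phi> \<alpha> (- \<tau>)) * b)"
    by (simp add: ennreal_leI)
  have "integrable M (\<lambda>\<omega>. (norm (X \<omega>))\<^sup>2)"
    using order.strict_trans1[OF bound ennreal_less_top] by (intro integrableI_bounded) simp_all
  moreover have "(\<integral>\<omega>. (norm (X \<omega>))\<^sup>2 \<partial>M) \<le> 2 * C * op_trace \<phi> (A_powr \<phi> \<alpha> (- \<tau>)) * b"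
    using b \<open>C > 0\<close> trace_nonneg by (intro integral_real_bounded bound) (simp add: trace)
  ultimately show ?thesis
    by (simp add: X_def)
qed

end
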